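(* Let $\mathcal{C}$ be an S-positive subcategory of a quantum Markov category such that $\mathcal{C}$ contains, for each object $X$ of $\mathcal{C}$, the morphisms $!_X:X\to I$, $\ !_X\otimes\mathrm{id}_X:X\otimes X\to X$ and $\mathrm{id}_X\otimes{!_X}:X\otimes X\to X$. In addition, suppose that for every object $X$ of $\mathcal{C}$, the category $\mathcal{C}$ contains a morphism $\nabla_X:X\to X\otimes X$ satisfying $$(!_X\otimes\mathrm{id}_X)\circ\nabla_X=\mathrm{id}_X=(\mathrm{id}_X\otimes{!_X})\circ\nabla_X .$$ Then, for every object $X$ of $\mathcal{C}$, $\nabla_X$ is commutative, i.e. $c_{X,X}\circ\nabla_X=\nabla_X$ (with $c$ the symmetry), and in fact $\nabla_X=\Delta_X$.
   Context: A $\mathbb{Z}_2$-monoidal category is a category $\mathcal{M}$ in which every morphism has a grade in $\mathbb{Z}_2=\{0,1\}$ ($0$ = even, $1$ = odd), identities being even and grades adding under composition, such that for each object $X$ and each grade there is an isomorphism with source $X$ of that grade; together with a tensor product assigning $X\otimes Y$ to objects and $f\otimes f'$ (of the common grade) to pairs of morphisms of equal grade, functorially; a unit object $I$ with a chosen odd involution $*_I$ of $I$; and even natural isomorphisms (associator, symmetry $c_{X,Y}:X\otimes Y\to Y\otimes X$, unitor $I\otimes X\to X$) satisfying the usual axioms of a symmetric monoidal category. Associators and unitors are suppressed. A quantum CD category is a $\mathbb{Z}_2$-monoidal category with, for each object $X$, even morphisms $\Delta_X:X\to X\otimes X$ (copy), $!_X:X\to I$ (discard) and an odd morphism $*_X:X\to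 X$ such that: $(!_X\otimes\mathrm{id})\Delta_X=\mathrm{id}_X=(\mathrm{id}\otimes{!_X})\Delta_X$; $(\Delta_X\otimes\mathrm{id})\Delta_X=(\mathrm{id}\otimes\Delta_X)\Delta_X$; $c_{X,X}( *_X\otimes*_X)\Delta_X=\Delta_X*_X$; $!_{X\otimes Y}={!_X}\otimes{!_Y}$; $!_I=\mathrm{id}_I$; $\Delta_{X\otimes Y}=(\mathrm{id}_X\otimes c_{X,Y}\otimes\mathrm{id}_Y)(\Delta_X\otimes\Delta_Y)$; $\Delta_I=\mathrm{id}_I$; $*_X*_X=\mathrm{id}_X$; $*_{X\otimes Y}=*_X\otimes*_Y$; $!_X*_X=*_I\,!_X$. It is a quantum Markov category if moreover every even $f:X\to Y$ satisfies $!_Y f={!_X}$ and every odd $f:X\to Y$ satisfies $!_Yf={!_X}*_X$. A morphism $f:X\to Y$ is $*$-preserving if $f*_X=*_Yf$. An even morphism $f:X\to Y$ is deterministic if it is $*$-preserving and $\Delta_Yf=(f\otimes f)\Delta_X$. A subcategory $\mathcal{C}$ consisting of even morphisms is S-positive if for every composable pair $X\xrightarrow{f}Y\xrightarrow{g}Z$ in $\mathcal{C}$ with $g\circ f$ deterministic, $(g\otimes\mathrm{id}_Y)\Delta_Yf=((g\circ f)\otimes f)\Delta_X$. (The subcategory need not be monoidal nor contain $\Delta$.) *)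

theory Defs
  imports "HOL-Library.Z2"
begin

text \<open>
  Categories are records over a type of objects and a type of morphisms, with carrier sets.
  The operations are total functions, constrained only on the carriers, on composable pairs
  and (for the tensor product of morphisms) on pairs of equal grade.
\<close>

record ('o, 'm) z2_category =
  Obj :: "'o set"
  Arr :: "'m set"
  src :: "'m \<Rightarrow> 'o"
  trg :: "'m \<Rightarrow> 'o"
  grade :: "'m \<Rightarrow> bit"
  ident :: "'o \<Rightarrow> 'm"
  comp :: "'m \<Rightarrow> 'm \<Rightarrow> 'm" (infixr "\<cdot>\<index>" 70)

record ('o, 'm) z2_monoidal_category = "('o, 'm) z2_category" +
  tens_obj :: "'o \<Rightarrow> 'o \<Rightarrow> 'o" (infixr "\<otimes>\<^sub>o\<index>" 75)
  tens_arr :: "'m \<Rightarrow> 'm \<Rightarrow> 'm" (infixr "\<otimes>\<^sub>m\<index>" 75)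
  unit_obj :: "'o"
  unit_star :: "'m"
  assoc :: "'o \<Rightarrow> 'o \<Rightarrow> 'o \<Rightarrow> 'm"
  symm :: "'o \<Rightarrow> 'o \<Rightarrow> 'm"
  lunit :: "'o \<Rightarrow> 'm"

record ('o, 'm) quantum_cd_category = "('o, 'm) z2_monoidal_category" +
  copy :: "'o \<Rightarrow> 'm"
  discard :: "'o \<Rightarrow> 'm"
  star :: "'o \<Rightarrow> 'm"

definition Hom :: "('o, 'm, 'b) z2_category_scheme \<Rightarrow> bit \<Rightarrow> 'o \<Rightarrow> 'o \<Rightarrow> 'm set" where
  "Hom M e X Y = {f \<in> Arr M. src M f = X \<and> trg M f = Y \<and> grade M f = e}"

definition is_inverse :: "('o, 'm, 'b) z2_category_scheme \<Rightarrow> 'm \<Rightarrow> 'm \<Rightarrow> bool" where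
  "is_inverse M f g \<longleftrightarrow> f \<in> Arr M \<and> g \<in> Arr M \<and> src M g = trg M f \<and> trg M g = src M f \<and>
     comp M g f = ident M (src M f) \<and> comp M f g = ident M (trg M f)"

definition is_iso :: "('o, 'm, 'b) z2_category_scheme \<Rightarrow> 'm \<Rightarrow> bool" where
  "is_iso M f \<longleftrightarrow> (\<exists>g. is_inverse M f g)"

definition inv_arr :: "('o, 'm, 'b) z2_category_scheme \<Rightarrow> 'm \<Rightarrow> 'm" where
  "inv_arr M f = (THE g. is_inverse M f g)"

locale z2_category =
  fixes M :: "('o, 'm, 'b) z2_category_scheme" (structure)
  assumes src_in_Obj: "f \<in> Arr M \<Longrightarrow> src M f \<in> Obj M"
    and trg_in_Obj: "f \<in> Arr M \<Longrightarrow> trg M f \<in> Obj M"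
    and ident_in_Hom: "X \<in> Obj M \<Longrightarrow> ident M X \<in> Hom M 0 X X"
    and comp_in_Hom: "f \<in> Hom M d X Y \<Longrightarrow> g \<in> Hom M e Y Z \<Longrightarrow> g \<cdot> f \<in> Hom M (e + d) X Z"
    and comp_ident: "f \<in> Arr M \<Longrightarrow> f \<cdot> ident M (src M f) = f"
    and ident_comp: "f \<in> Arr M \<Longrightarrow> ident M (trg M f) \<cdot> f = f"
    and comp_assoc: "f \<in> Hom M d W X \<Longrightarrow> g \<in> Hom M e X Y \<Longrightarrow> h \<in> Hom M e' Y Z \<Longrightarrow>
      h \<cdot> (g \<cdot> f) = (h \<cdot> g) \<cdot> f"
    and iso_of_grade: "X \<in> Obj M \<Longrightarrow> \<exists>f. is_iso M f \<and> src M f = X \<and> grade M f = e"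

text \<open>
  The endofunctor taking an object X to the tensor product of the unit with X acts on a
  morphism by tensoring with the identity of the unit or with its chosen involution, according
  to the grade; the left unitor is natural with respect to this functor.
\<close>

definition unit_arr :: "('o, 'm, 'b) z2_monoidal_category_scheme \<Rightarrow> bit \<Rightarrow> 'm" where
  "unit_arr M e = (if e = 0 then ident M (unit_obj M) else unit_star M)"

definition runit :: "('o, 'm, 'b) z2_monoidal_category_scheme \<Rightarrow> 'o \<Rightarrow> 'm" where
  "runit M X = comp M (lunit M X) (symm M X (unit_obj M))"

locale z2_monoidal_category = z2_category M
  for M :: "('o, 'm, 'b) z2_monoidal_category_scheme" (structure) +
  assumes tens_obj_in_Obj: "X \<in> Obj M \<Longrightarrow> Y \<in> Obj M \<Longrightarrow> X \<otimes>\<^sub>o Y \<in> Obj M"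
    and tens_arr_in_Hom: "f \<in> Hom M e X Y \<Longrightarrow> f' \<in> Hom M e X' Y' \<Longrightarrow>
      f \<otimes>\<^sub>m f' \<in> Hom M e (X \<otimes>\<^sub>o X') (Y \<otimes>\<^sub>o Y')"
    and tens_ident: "X \<in> Obj M \<Longrightarrow> Y \<in> Obj M \<Longrightarrow>
      ident M X \<otimes>\<^sub>m ident M Y = ident M (X \<otimes>\<^sub>o Y)"
    and tens_comp: "f \<in> Hom M d X Y \<Longrightarrow> g \<in> Hom M e Y Z \<Longrightarrow>
      f' \<in> Hom M d X' Y' \<Longrightarrow> g' \<in> Hom M e Y' Z' \<Longrightarrow>
      (g \<cdot> f) \<otimes>\<^sub>m (g' \<cdot> f') = (g \<otimes>\<^sub>m g') \<cdot> (f \<otimes>\<^sub>m f')"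
    and unit_in_Obj: "unit_obj M \<in> Obj M"
    and unit_star_in_Hom: "unit_star M \<in> Hom M 1 (unit_obj M) (unit_obj M)"
    and unit_star_invol: "unit_star M \<cdot> unit_star M = ident M (unit_obj M)"
    and assoc_in_Hom: "X \<in> Obj M \<Longrightarrow> Y \<in> Obj M \<Longrightarrow> Z \<in> Obj M \<Longrightarrow>
      assoc M X Y Z \<in> Hom M 0 ((X \<otimes>\<^sub>o Y) \<otimes>\<^sub>o Z) (X \<otimes>\<^sub>o (Y \<otimes>\<^sub>o Z))"
    and assoc_iso: "X \<in> Obj M \<Longrightarrow> Y \<in> Obj M \<Longrightarrow> Z \<in> Obj M \<Longrightarrow> is_iso M (assoc M X Y Z)"
    and assoc_natural: "f \<in> Hom M e X X' \<Longrightarrow> g \<in> Hom M e Y Y' \<Longrightarrow> h \<in> Hom M e Z Z' \<Longrightarrow>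
      assoc M X' Y' Z' \<cdot> ((f \<otimes>\<^sub>m g) \<otimes>\<^sub>m h) = (f \<otimes>\<^sub>m (g \<otimes>\<^sub>m h)) \<cdot> assoc M X Y Z"
    and symm_in_Hom: "X \<in> Obj M \<Longrightarrow> Y \<in> Obj M \<Longrightarrow>
      symm M X Y \<in> Hom M 0 (X \<otimes>\<^sub>o Y) (Y \<otimes>\<^sub>o X)"
    and symm_natural: "f \<in> Hom M e X X' \<Longrightarrow> g \<in> Hom M e Y Y' \<Longrightarrow>
      symm M X' Y' \<cdot> (f \<otimes>\<^sub>m g) = (g \<otimes>\<^sub>m f) \<cdot> symm M X Y"
    and symm_symm: "X \<in> Obj M \<Longrightarrow> Y \<in> Obj M \<Longrightarrow>
      symm M Y X \<cdot> symm M X Y = ident M (X \<otimes>\<^sub>o Y)"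
    and lunit_in_Hom: "X \<in> Obj M \<Longrightarrow> lunit M X \<in> Hom M 0 (unit_obj M \<otimes>\<^sub>o X) X"
    and lunit_iso: "X \<in> Obj M \<Longrightarrow> is_iso M (lunit M X)"
    and lunit_natural: "f \<in> Hom M e X Y \<Longrightarrow>
      lunit M Y \<cdot> (unit_arr M e \<otimes>\<^sub>m f) = f \<cdot> lunit M X"
    and pentagon: "W \<in> Obj M \<Longrightarrow> X \<in> Obj M \<Longrightarrow> Y \<in> Obj M \<Longrightarrow> Z \<in> Obj M \<Longrightarrow>
      assoc M W X (Y \<otimes>\<^sub>o Z) \<cdot> assoc M (W \<otimes>\<^sub>o X) Y Z =
      (ident M W \<otimes>\<^sub>m assoc M X Y Z) \<cdot> assoc M W (X \<otimes>\<^sub>o Y) Z \<cdot>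
        (assoc M W X Y \<otimes>\<^sub>m ident M Z)"
    and triangle: "X \<in> Obj M \<Longrightarrow> Y \<in> Obj M \<Longrightarrow>
      (ident M X \<otimes>\<^sub>m lunit M Y) \<cdot> assoc M X (unit_obj M) Y = runit M X \<otimes>\<^sub>m ident M Y"
    and hexagon: "X \<in> Obj M \<Longrightarrow> Y \<in> Obj M \<Longrightarrow> Z \<in> Obj M \<Longrightarrow>
      assoc M Y Z X \<cdot> symm M X (Y \<otimes>\<^sub>o Z) \<cdot> assoc M X Y Z =
      (ident M Y \<otimes>\<^sub>m symm M X Z) \<cdot> assoc M Y X Z \<cdot> (symm M X Y \<otimes>\<^sub>m ident M Z)"

text \<open>
  The exchange of the two middle factors, that is, the identity of X tensored with the symmetry
  of X and Y tensored with the identity of Y, from \<open>(X \<otimes> X) \<otimes> (Y \<otimes> Y)\<close> to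
  \<open>(X \<otimes> Y) \<otimes> (X \<otimes> Y)\<close>.
\<close>

definition mid_swap :: "('o, 'm, 'b) z2_monoidal_category_scheme \<Rightarrow> 'o \<Rightarrow> 'o \<Rightarrow> 'm" where
  "mid_swap M X Y =
     comp M (inv_arr M (assoc M X Y (tens_obj M X Y)))
    (comp M (tens_arr M (ident M X)
        (comp M (assoc M Y X Y)
        (comp M (tens_arr M (symm M X Y) (ident M Y))
          (inv_arr M (assoc M X Y Y)))))
      (assoc M X X (tens_obj M Y Y)))"

text \<open>
  Below, the associators and unitors that are usually suppressed are inserted. The axioms
  \<open>discard_unit\<close> and \<open>discard_star\<close>, taken at the unit object, say that \<open>star\<close> of the unit object
  is the chosen involution \<open>unit_star\<close>.
\<close>

locale quantum_cd_category = z2_monoidal_category M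
  for M :: "('o, 'm, 'b) quantum_cd_category_scheme" (structure) +
  assumes copy_in_Hom: "X \<in> Obj M \<Longrightarrow> copy M X \<in> Hom M 0 X (X \<otimes>\<^sub>o X)"
    and discard_in_Hom: "X \<in> Obj M \<Longrightarrow> discard M X \<in> Hom M 0 X (unit_obj M)"
    and star_in_Hom: "X \<in> Obj M \<Longrightarrow> star M X \<in> Hom M 1 X X"
    and copy_counit_left: "X \<in> Obj M \<Longrightarrow>
      lunit M X \<cdot> (discard M X \<otimes>\<^sub>m ident M X) \<cdot> copy M X = ident M X"
    and copy_counit_right: "X \<in> Obj M \<Longrightarrow>
      runit M X \<cdot> (ident M X \<otimes>\<^sub>m discard M X) \<cdot> copy M X = ident M X"
    and copy_coassoc: "X \<in> Obj M \<Longrightarrow>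
      assoc M X X X \<cdot> (copy M X \<otimes>\<^sub>m ident M X) \<cdot> copy M X =
      (ident M X \<otimes>\<^sub>m copy M X) \<cdot> copy M X"
    and copy_star: "X \<in> Obj M \<Longrightarrow>
      symm M X X \<cdot> (star M X \<otimes>\<^sub>m star M X) \<cdot> copy M X = copy M X \<cdot> star M X"
    and discard_tens: "X \<in> Obj M \<Longrightarrow> Y \<in> Obj M \<Longrightarrow>
      discard M (X \<otimes>\<^sub>o Y) = lunit M (unit_obj M) \<cdot> (discard M X \<otimes>\<^sub>m discard M Y)"
    and discard_unit: "discard M (unit_obj M) = ident M (unit_obj M)"
    and copy_tens: "X \<in> Obj M \<Longrightarrow> Y \<in> Obj M \<Longrightarrow>
      copy M (X \<otimes>\<^sub>o Y) = mid_swap M X Y \<cdot> (copy M X \<otimes>\<^sub>m copy M Y)"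
    and copy_unit: "copy M (unit_obj M) = inv_arr M (lunit M (unit_obj M))"
    and star_star: "X \<in> Obj M \<Longrightarrow> star M X \<cdot> star M X = ident M X"
    and star_tens: "X \<in> Obj M \<Longrightarrow> Y \<in> Obj M \<Longrightarrow>
      star M (X \<otimes>\<^sub>o Y) = star M X \<otimes>\<^sub>m star M Y"
    and discard_star: "X \<in> Obj M \<Longrightarrow> discard M X \<cdot> star M X = unit_star M \<cdot> discard M X"

locale quantum_markov_category = quantum_cd_category M
  for M :: "('o, 'm, 'b) quantum_cd_category_scheme" (structure) +
  assumes discard_even: "f \<in> Hom M 0 X Y \<Longrightarrow> discard M Y \<cdot> f = discard M X"
    and discard_odd: "f \<in> Hom M 1 X Y \<Longrightarrow> discard M Y \<cdot> f = discard M X \<cdot> star M X"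

definition star_preserving :: "('o, 'm, 'b) quantum_cd_category_scheme \<Rightarrow> 'm \<Rightarrow> bool" where
  "star_preserving M f \<longleftrightarrow> f \<in> Arr M \<and>
     comp M f (star M (src M f)) = comp M (star M (trg M f)) f"

definition deterministic :: "('o, 'm, 'b) quantum_cd_category_scheme \<Rightarrow> 'm \<Rightarrow> bool" where
  "deterministic M f \<longleftrightarrow> f \<in> Arr M \<and> grade M f = 0 \<and> star_preserving M f \<and>
     comp M (copy M (trg M f)) f = comp M (tens_arr M f f) (copy M (src M f))"

locale subcategory =
  fixes M :: "('o, 'm, 'b) z2_category_scheme" (structure)
    and CO :: "'o set" and CA :: "'m set"
  assumes sub_Obj: "CO \<subseteq> Obj M"
    and sub_Arr: "CA \<subseteq> Arr M"
    and sub_src: "f \<in> CA \<Longrightarrow> src M f \<in> CO"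
    and sub_trg: "f \<in> CA \<Longrightarrow> trg M f \<in> CO"
    and sub_ident: "X \<in> CO \<Longrightarrow> ident M X \<in> CA"
    and sub_comp: "f \<in> CA \<Longrightarrow> g \<in> CA \<Longrightarrow> trg M f = src M g \<Longrightarrow> g \<cdot> f \<in> CA"

locale S_positive_subcategory = subcategory M CO CA
  for M :: "('o, 'm, 'b) quantum_cd_category_scheme" (structure)
    and CO :: "'o set" and CA :: "'m set" +
  assumes sub_even: "f \<in> CA \<Longrightarrow> grade M f = 0"
    and S_positive: "f \<in> CA \<Longrightarrow> g \<in> CA \<Longrightarrow> trg M f = src M g \<Longrightarrow> deterministic M (g \<cdot> f) \<Longrightarrow>
      (g \<otimes>\<^sub>m ident M (trg M f)) \<cdot> copy M (trg M f) \<cdot> f = ((g \<cdot> f) \<otimes>\<^sub>m f) \<cdot> copy M (src M f)"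

end

theory Submission
  imports Defs
begin

text \<open>
  Write \<open>p = id \<otimes> !\<close> and \<open>q = ! \<otimes> id\<close> for the two marginalisations. Since \<open>p \<cdot> \<nabla>\<close> and
  \<open>q \<cdot> \<nabla>\<close> are identities, hence deterministic, S-positivity applies to both composites and gives
  \<open>(p \<otimes> id) \<cdot> \<Delta> \<cdot> \<nabla> = (id \<otimes> \<nabla>) \<cdot> \<Delta> = (q \<otimes> id) \<cdot> \<Delta> \<cdot> \<nabla>\<close>, where the outer \<open>\<Delta>\<close> copies
  \<open>X \<otimes> X\<close>. Marginalising the second factor by \<open>q\<close> and by \<open>p\<close>, respectively, the middle term becomes
  \<open>\<Delta>\<close>, while \<open>(p \<otimes> q) \<cdot> \<Delta> = id\<close> and \<open>(q \<otimes> p) \<cdot> \<Delta> = c\<close> hold on any tensor product. Thus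
  \<open>\<nabla> = \<Delta> = c \<cdot> \<nabla>\<close>.
\<close>

section \<open>Even morphisms\<close>

text \<open>Keeping parity as a predicate, separate from \<open>Hom\<close>, lets source and target
  be computed by rewriting, so simplification discharges the typing conditions of the laws below.
  The \<open>star\<close> in \<open>deterministic_ident\<close> is treated outside this
  setting.\<close>

definition even_arr :: "('o, 'm, 'b) z2_category_scheme \<Rightarrow> 'm \<Rightarrow> bool" where
  "even_arr M f \<longleftrightarrow> f \<in> Arr M \<and> grade M f = 0"

lemma Hom_even_iff:
  "f \<in> Hom M 0 X Y \<longleftrightarrow> even_arr M f \<and> src M f = X \<and> trg M f = Y"
  by (auto simp: Hom_def even_arr_def)

context z2_category
begin

lemma even_src_trg [simp]:
  assumes "even_arr M f"
  shows "src M f \<in> Obj M" "trg M f \<in> Obj M"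
  using assms src_in_Obj trg_in_Obj by (auto simp: even_arr_def)

lemma even_ident [simp]:
  assumes "X \<in> Obj M"
  shows "even_arr M (ident M X)" "src M (ident M X) = X" "trg M (ident M X) = X"
  using ident_in_Hom[OF assms] by (auto simp: Hom_even_iff)

lemma even_comp [simp]:
  assumes "even_arr M f" "even_arr M g" "trg M f = src M g"
  shows "even_arr M (g \<cdot> f)" "src M (g \<cdot> f) = src M f" "trg M (g \<cdot> f) = trg M g"
  using comp_in_Hom[of f 0 "src M f" "trg M f" g 0 "trg M g"] assms
  by (auto simp: Hom_even_iff)

lemma even_comp_ident [simp]:
  assumes "even_arr M f"
  shows "src M f = X \<Longrightarrow> f \<cdot> ident M X = f" "trg M f = X \<Longrightarrow> ident M X \<cdot> f = f"
  using assms comp_ident ident_comp by (auto simp: even_arr_def)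

text \<open>As a simplification rule this nests composites to the right. Where a law matches a pair
  of factors bracketed to the left, the symmetric form is invoked explicitly below.\<close>

lemma even_comp_assoc [simp]:
  assumes "even_arr M f" "even_arr M g" "even_arr M h" "trg M f = src M g" "trg M g = src M h"
  shows "(h \<cdot> g) \<cdot> f = h \<cdot> g \<cdot> f"
  using comp_assoc[of f 0 "src M f" "trg M f" g 0 "trg M g" h 0 "trg M h"] assms
  by (auto simp: Hom_even_iff)

section \<open>Inverses, isomorphisms and cancellation\<close>

lemma is_inverse_unique:
  assumes f: "even_arr M f" and g: "is_inverse M f g" and h: "is_inverse M f h"
  shows "g = h"
proof -
  \<comment> \<open>\<open>is_inverse\<close> says nothing about grades, so the grade of an inverse
    is left open here; associativity holds for all grades.\<close>
  have hom: "k \<in> Hom M (grade M k) (trg M f) (src M f)" if "is_inverse M f k" for k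
    using that by (auto simp: is_inverse_def Hom_def)
  have fH: "f \<in> Hom M 0 (src M f) (trg M f)"
    using f by (simp add: Hom_even_iff)
  have "g = (h \<cdot> f) \<cdot> g"
    using g h ident_comp[of g] by (simp add: is_inverse_def)
  also have "\<dots> = h \<cdot> f \<cdot> g"
    using comp_assoc[OF hom[OF g] fH hom[OF h]] by simp
  also have "\<dots> = h"
    using g h comp_ident[of h] by (simp add: is_inverse_def)
  finally show ?thesis .
qed

lemma inv_arr_is_inverse:
  assumes "even_arr M f" "is_iso M f"
  shows "is_inverse M f (inv_arr M f)"
  unfolding inv_arr_def
  by (rule theI') (use assms is_inverse_unique in \<open>auto simp: is_iso_def\<close>)

lemma even_inv_arr:
  assumes "even_arr M f" "is_iso M f"
  shows "even_arr M (inv_arr M f)" "src M (inv_arr M f) = trg M f"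
    "trg M (inv_arr M f) = src M f"
    "inv_arr M f \<cdot> f = ident M (src M f)" "f \<cdot> inv_arr M f = ident M (trg M f)"
proof -
  note inv = inv_arr_is_inverse[OF assms]
  show st: "src M (inv_arr M f) = trg M f" "trg M (inv_arr M f) = src M f"
    and i: "inv_arr M f \<cdot> f = ident M (src M f)" "f \<cdot> inv_arr M f = ident M (trg M f)"
    using inv by (auto simp: is_inverse_def)
  \<comment> \<open>Grades add under composition and this composite is an even identity, so the
    inverse of an even morphism is itself even.\<close>
  have "inv_arr M f \<cdot> f \<in> Hom M (grade M (inv_arr M f) + 0) (src M f) (src M f)"
    by (rule comp_in_Hom[of _ _ _ "trg M f"])
      (use inv assms in \<open>auto simp: Hom_def is_inverse_def even_arr_def\<close>)
  with i assms(1) have "grade M (inv_arr M f) = 0"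
    using even_ident(1)[of "src M f"] by (simp add: Hom_def even_arr_def)
  with inv show "even_arr M (inv_arr M f)"
    by (simp add: even_arr_def is_inverse_def)
qed

lemma is_isoI:
  assumes "even_arr M f" "even_arr M g" "src M g = trg M f" "trg M g = src M f"
    "g \<cdot> f = ident M (src M f)" "f \<cdot> g = ident M (trg M f)"
  shows "is_iso M f"
  using assms unfolding is_iso_def is_inverse_def even_arr_def by blast

lemma iso_epi:
  assumes e: "even_arr M e" "is_iso M e"
    and "even_arr M f" "even_arr M g" "src M f = trg M e" "src M g = trg M e"
    and "f \<cdot> e = g \<cdot> e"
  shows "f = g"
proof -
  note [simp] = even_inv_arr[OF e]
  have "f = (f \<cdot> e) \<cdot> inv_arr M e" using assms(1-6) by simp
  also have "\<dots> = (g \<cdot> e) \<cdot> inv_arr M e" using assms(7) by simp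
  also have "\<dots> = g" using assms(1-6) by simp
  finally show ?thesis .
qed

lemma iso_mono:
  assumes e: "even_arr M e" "is_iso M e"
    and "even_arr M f" "even_arr M g" "trg M f = src M e" "trg M g = src M e"
    and "e \<cdot> f = e \<cdot> g"
  shows "f = g"
proof -
  note i = even_inv_arr[OF e]
  have "f = inv_arr M e \<cdot> e \<cdot> f"
    using assms(1-6) i even_comp_assoc[of f e "inv_arr M e"] by simp
  also have "\<dots> = inv_arr M e \<cdot> e \<cdot> g" using assms(7) by simp
  also have "\<dots> = g"
    using assms(1-6) i even_comp_assoc[of g e "inv_arr M e"] by simp
  finally show ?thesis .
qed

lemma iso_comp:
  assumes f: "even_arr M f" "is_iso M f" and g: "even_arr M g" "is_iso M g"
    and t: "trg M f = src M g"
  shows "is_iso M (g \<cdot> f)"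
proof (rule is_isoI)
  note [simp] = even_inv_arr[OF f] even_inv_arr[OF g] f g t
  \<comment> \<open>The adjacent inverse pair cancels only after bracketing to the left, against the
    direction of simplification, so this cancellation is supplied as a separate fact.\<close>
  have "inv_arr M g \<cdot> g \<cdot> f = f"
    using even_comp_assoc[of f g "inv_arr M g"] by simp
  thus "(inv_arr M f \<cdot> inv_arr M g) \<cdot> g \<cdot> f = ident M (src M (g \<cdot> f))" by simp
  have "f \<cdot> inv_arr M f \<cdot> inv_arr M g = inv_arr M g"
    using even_comp_assoc[of "inv_arr M g" "inv_arr M f" f] by simp
  thus "(g \<cdot> f) \<cdot> inv_arr M f \<cdot> inv_arr M g = ident M (trg M (g \<cdot> f))" by simp
qed (use even_inv_arr[OF f] even_inv_arr[OF g] f g t in auto)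

end

section \<open>Coherence in symmetric monoidal categories\<close>

context z2_monoidal_category
begin

section \<open>Typing and naturality for even morphisms\<close>

abbreviation (input) I :: 'o where
  "I \<equiv> unit_obj M"

lemma unit_in_Obj' [simp]: "unit_obj M \<in> Obj M"
  by (rule unit_in_Obj)

lemma tens_obj_in_Obj' [simp]: "X \<in> Obj M \<Longrightarrow> Y \<in> Obj M \<Longrightarrow> X \<otimes>\<^sub>o Y \<in> Obj M"
  by (rule tens_obj_in_Obj)

lemma even_tens [simp]:
  assumes "even_arr M f" "even_arr M g"
  shows "even_arr M (f \<otimes>\<^sub>m g)" "src M (f \<otimes>\<^sub>m g) = src M f \<otimes>\<^sub>o src M g"
    "trg M (f \<otimes>\<^sub>m g) = trg M f \<otimes>\<^sub>o trg M g"
  using tens_arr_in_Hom[of f 0 "src M f" "trg M f" g "src M g" "trg M g"] assms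
  by (auto simp: Hom_even_iff)

declare tens_ident [simp]

lemma even_tens_comp:
  assumes "even_arr M f" "even_arr M g" "even_arr M f'" "even_arr M g'"
    "trg M f = src M g" "trg M f' = src M g'"
  shows "(g \<otimes>\<^sub>m g') \<cdot> (f \<otimes>\<^sub>m f') = (g \<cdot> f) \<otimes>\<^sub>m (g' \<cdot> f')"
  using tens_comp[of f 0 "src M f" "trg M f" g 0 "trg M g" f' "src M f'" "trg M f'" g' "trg M g'"]
    assms by (auto simp: Hom_even_iff)

text \<open>Inside a longer right-nested composite, two adjacent tensors are not a subterm; the
  trailing factor \<open>k\<close> lets the interchange law rewrite there too.\<close>

lemma even_tens_comp':
  assumes "even_arr M f" "even_arr M g" "even_arr M f'" "even_arr M g'" "even_arr M k"
    "trg M f = src M g" "trg M f' = src M g'" "trg M k = src M f \<otimes>\<^sub>o src M f'"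
  shows "(g \<otimes>\<^sub>m g') \<cdot> (f \<otimes>\<^sub>m f') \<cdot> k = ((g \<cdot> f) \<otimes>\<^sub>m (g' \<cdot> f')) \<cdot> k"
  using assms even_comp_assoc[of k "f \<otimes>\<^sub>m f'" "g \<otimes>\<^sub>m g'"] by (simp add: even_tens_comp)

lemma even_assoc_symm [simp]:
  assumes [simp]: "X \<in> Obj M" "Y \<in> Obj M"
  shows "Z \<in> Obj M \<Longrightarrow> even_arr M (assoc M X Y Z)"
    "Z \<in> Obj M \<Longrightarrow> src M (assoc M X Y Z) = (X \<otimes>\<^sub>o Y) \<otimes>\<^sub>o Z"
    "Z \<in> Obj M \<Longrightarrow> trg M (assoc M X Y Z) = X \<otimes>\<^sub>o Y \<otimes>\<^sub>o Z"
    "even_arr M (symm M X Y)" "src M (symm M X Y) = X \<otimes>\<^sub>o Y" "trg M (symm M X Y) = Y \<otimes>\<^sub>o X"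
  using assoc_in_Hom[of X Y Z] symm_in_Hom[of X Y] by (auto simp: Hom_even_iff)

lemma even_lunit [simp]:
  assumes "X \<in> Obj M"
  shows "even_arr M (lunit M X)" "src M (lunit M X) = I \<otimes>\<^sub>o X" "trg M (lunit M X) = X"
  using lunit_in_Hom[OF assms] by (auto simp: Hom_even_iff)

lemma even_runit [simp]:
  assumes "X \<in> Obj M"
  shows "even_arr M (runit M X)" "src M (runit M X) = X \<otimes>\<^sub>o I" "trg M (runit M X) = X"
  using assms by (auto simp: runit_def)

lemma even_assoc_inv [simp]:
  assumes [simp]: "X \<in> Obj M" "Y \<in> Obj M" "Z \<in> Obj M"
  shows "even_arr M (inv_arr M (assoc M X Y Z))"
    "src M (inv_arr M (assoc M X Y Z)) = X \<otimes>\<^sub>o Y \<otimes>\<^sub>o Z"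
    "trg M (inv_arr M (assoc M X Y Z)) = (X \<otimes>\<^sub>o Y) \<otimes>\<^sub>o Z"
    "inv_arr M (assoc M X Y Z) \<cdot> assoc M X Y Z = ident M ((X \<otimes>\<^sub>o Y) \<otimes>\<^sub>o Z)"
    "assoc M X Y Z \<cdot> inv_arr M (assoc M X Y Z) = ident M (X \<otimes>\<^sub>o Y \<otimes>\<^sub>o Z)"
  using even_inv_arr[OF _ assoc_iso, of X Y Z] by auto

lemma even_assoc_natural:
  assumes "even_arr M f" "even_arr M g" "even_arr M h"
  shows "assoc M (trg M f) (trg M g) (trg M h) \<cdot> ((f \<otimes>\<^sub>m g) \<otimes>\<^sub>m h) =
    (f \<otimes>\<^sub>m g \<otimes>\<^sub>m h) \<cdot> assoc M (src M f) (src M g) (src M h)"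
  using assms assoc_natural[of f 0 "src M f" "trg M f" g "src M g" "trg M g" h "src M h" "trg M h"]
  by (auto simp: Hom_even_iff)

text \<open>Precomposed with the associator at the sources, which is invertible, both sides reduce
  to \<open>?l\<close>: the right one by cancellation, the left one by naturality of the
  associator.\<close>

lemma assoc_inv_natural:
  assumes [simp]: "even_arr M f" "even_arr M g" "even_arr M h"
  shows "inv_arr M (assoc M (trg M f) (trg M g) (trg M h)) \<cdot> (f \<otimes>\<^sub>m g \<otimes>\<^sub>m h) =
    ((f \<otimes>\<^sub>m g) \<otimes>\<^sub>m h) \<cdot> inv_arr M (assoc M (src M f) (src M g) (src M h))"
    (is "?b \<cdot> ?r = ?l \<cdot> ?b'")
proof (rule iso_epi[of "assoc M (src M f) (src M g) (src M h)"])
  let ?a = "assoc M (trg M f) (trg M g) (trg M h)"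
  have "(?b \<cdot> ?r) \<cdot> assoc M (src M f) (src M g) (src M h) = ?b \<cdot> ?a \<cdot> ?l"
    by (simp add: even_assoc_natural)
  also have "\<dots> = (?b \<cdot> ?a) \<cdot> ?l"
    by (rule even_comp_assoc[symmetric]) auto
  also have "\<dots> = (?l \<cdot> ?b') \<cdot> assoc M (src M f) (src M g) (src M h)"
    by simp
  finally show "(?b \<cdot> ?r) \<cdot> assoc M (src M f) (src M g) (src M h) = \<dots>" .
qed (auto intro: assoc_iso)

lemma even_symm_natural:
  assumes "even_arr M f" "even_arr M g"
  shows "symm M (trg M f) (trg M g) \<cdot> (f \<otimes>\<^sub>m g) = (g \<otimes>\<^sub>m f) \<cdot> symm M (src M f) (src M g)"
  using assms symm_natural[of f 0 "src M f" "trg M f" g "src M g" "trg M g"]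
  by (auto simp: Hom_even_iff)

lemma even_lunit_natural:
  assumes "even_arr M f"
  shows "lunit M (trg M f) \<cdot> (ident M I \<otimes>\<^sub>m f) = f \<cdot> lunit M (src M f)"
  using assms lunit_natural[of f 0 "src M f" "trg M f"]
  by (auto simp: Hom_even_iff unit_arr_def)

lemma even_runit_natural:
  assumes [simp]: "even_arr M f"
  shows "runit M (trg M f) \<cdot> (f \<otimes>\<^sub>m ident M I) = f \<cdot> runit M (src M f)"
proof -
  \<comment> \<open>The unit is written \<open>trg M (ident M I)\<close> so that
    \<open>even_symm_natural\<close> matches syntactically.\<close>
  have "runit M (trg M f) \<cdot> (f \<otimes>\<^sub>m ident M I) =
      lunit M (trg M f) \<cdot> symm M (trg M f) (trg M (ident M I)) \<cdot> (f \<otimes>\<^sub>m ident M I)"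
    by (simp add: runit_def)
  also have "\<dots> = (lunit M (trg M f) \<cdot> (ident M I \<otimes>\<^sub>m f)) \<cdot> symm M (src M f) I"
    by (subst even_symm_natural) auto
  also have "\<dots> = f \<cdot> runit M (src M f)"
    by (subst even_lunit_natural) (auto simp: runit_def)
  finally show ?thesis .
qed

section \<open>Coherence of the unitors\<close>

lemma symm_iso: "X \<in> Obj M \<Longrightarrow> Y \<in> Obj M \<Longrightarrow> is_iso M (symm M X Y)"
  by (rule is_isoI[of _ "symm M Y X"]) (auto simp: symm_symm)

lemma runit_iso: "X \<in> Obj M \<Longrightarrow> is_iso M (runit M X)"
  unfolding runit_def by (rule iso_comp) (auto intro: lunit_iso symm_iso)

text \<open>Naturality makes \<open>f\<close> after the unitor equal to the unitor after
  \<open>ident M I \<otimes>\<^sub>m f\<close>, and the unitor is epi. Equations may thus be checked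
  after tensoring with the unit, where the pentagon and the triangle become available.\<close>

lemma unit_tens_faithful:
  assumes [simp]: "even_arr M f" "even_arr M g" "src M f = src M g" "trg M f = trg M g"
    and eq: "ident M I \<otimes>\<^sub>m f = ident M I \<otimes>\<^sub>m g"
  shows "f = g"
  by (rule iso_epi[of "lunit M (src M g)"])
    (use even_lunit_natural[of f] even_lunit_natural[of g] eq in \<open>auto intro: lunit_iso\<close>)

lemma tens_unit_faithful:
  assumes [simp]: "even_arr M f" "even_arr M g" "src M f = src M g" "trg M f = trg M g"
    and eq: "f \<otimes>\<^sub>m ident M I = g \<otimes>\<^sub>m ident M I"
  shows "f = g"
  by (rule iso_epi[of "runit M (src M g)"])
    (use even_runit_natural[of f] even_runit_natural[of g] eq in \<open>auto intro: runit_iso\<close>)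

lemma tens_iso:
  assumes f: "even_arr M f" "is_iso M f" and g: "even_arr M g" "is_iso M g"
  shows "is_iso M (f \<otimes>\<^sub>m g)"
  by (rule is_isoI[of _ "inv_arr M f \<otimes>\<^sub>m inv_arr M g"])
    (use even_inv_arr[OF f] even_inv_arr[OF g] f g in \<open>auto simp: even_tens_comp\<close>)

lemma ident_iso: "X \<in> Obj M \<Longrightarrow> is_iso M (ident M X)"
  by (rule is_isoI[of _ "ident M X"]) auto

text \<open>Kelly's classical consequence of the pentagon and the triangle. After tensoring with the
  unit on the left, the pentagon for I, I, X, Y and two triangles give the identity up to a
  precomposed isomorphism.\<close>

lemma lunit_tens:
  assumes [simp]: "X \<in> Obj M" "Y \<in> Obj M"
  shows "lunit M (X \<otimes>\<^sub>o Y) \<cdot> assoc M I X Y = lunit M X \<otimes>\<^sub>m ident M Y"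
proof (rule unit_tens_faithful)
  \<comment> \<open>These are the two factors applied first on the longer side of the pentagon;
    their composite is invertible and is cancelled at the end.\<close>
  let ?k = "assoc M I (I \<otimes>\<^sub>o X) Y \<cdot> (assoc M I I X \<otimes>\<^sub>m ident M Y)"
  have "(ident M I \<otimes>\<^sub>m (lunit M (X \<otimes>\<^sub>o Y) \<cdot> assoc M I X Y)) \<cdot> ?k =
      (ident M I \<otimes>\<^sub>m lunit M (X \<otimes>\<^sub>o Y)) \<cdot> assoc M I I (X \<otimes>\<^sub>o Y) \<cdot> assoc M (I \<otimes>\<^sub>o I) X Y"
    by (subst pentagon) (auto simp: even_tens_comp')
  also have "\<dots> = ((ident M I \<otimes>\<^sub>m lunit M (X \<otimes>\<^sub>o Y)) \<cdot> assoc M I I (X \<otimes>\<^sub>o Y)) \<cdot> assoc M (I \<otimes>\<^sub>o I) X Y"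
    by (rule even_comp_assoc[symmetric]) auto
  also have "\<dots> = (runit M I \<otimes>\<^sub>m ident M (X \<otimes>\<^sub>o Y)) \<cdot> assoc M (I \<otimes>\<^sub>o I) X Y"
    by (simp add: triangle)
  also have "\<dots> = assoc M I X Y \<cdot> ((runit M I \<otimes>\<^sub>m ident M X) \<otimes>\<^sub>m ident M Y)"
    using even_assoc_natural[of "runit M I" "ident M X" "ident M Y"] by simp
  also have "\<dots> = assoc M I X Y \<cdot> ((ident M I \<otimes>\<^sub>m lunit M X) \<otimes>\<^sub>m ident M Y) \<cdot>
      (assoc M I I X \<otimes>\<^sub>m ident M Y)"
    by (simp add: even_tens_comp triangle)
  also have "\<dots> = (assoc M I X Y \<cdot> ((ident M I \<otimes>\<^sub>m lunit M X) \<otimes>\<^sub>m ident M Y)) \<cdot>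
      (assoc M I I X \<otimes>\<^sub>m ident M Y)"
    by (rule even_comp_assoc[symmetric]) auto
  also have "\<dots> = (ident M I \<otimes>\<^sub>m lunit M X \<otimes>\<^sub>m ident M Y) \<cdot> ?k"
    using even_assoc_natural[of "ident M I" "lunit M X" "ident M Y"] by simp
  \<comment> \<open>Rotating the premises of \<open>iso_epi\<close> puts the equation first, so that
    the chained fact determines which isomorphism is cancelled.\<close>
  finally show "ident M I \<otimes>\<^sub>m (lunit M (X \<otimes>\<^sub>o Y) \<cdot> assoc M I X Y) =
      ident M I \<otimes>\<^sub>m lunit M X \<otimes>\<^sub>m ident M Y"
    by (rule iso_epi[rotated 6])
      (auto intro!: iso_comp assoc_iso tens_iso ident_iso)
qed auto

text \<open>The mirror image of \<open>lunit_tens\<close>: tensor with the unit on the right, use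
  the pentagon for X, Y, I, I and two triangles, and cancel the associator on the left.\<close>

lemma runit_tens:
  assumes [simp]: "X \<in> Obj M" "Y \<in> Obj M"
  shows "(ident M X \<otimes>\<^sub>m runit M Y) \<cdot> assoc M X Y I = runit M (X \<otimes>\<^sub>o Y)"
proof (rule tens_unit_faithful)
  let ?l = "ident M X \<otimes>\<^sub>m ident M Y \<otimes>\<^sub>m lunit M I"
  have "assoc M X Y I \<cdot> (((ident M X \<otimes>\<^sub>m runit M Y) \<cdot> assoc M X Y I) \<otimes>\<^sub>m ident M I) =
      assoc M X Y I \<cdot> ((ident M X \<otimes>\<^sub>m runit M Y) \<otimes>\<^sub>m ident M I) \<cdot> (assoc M X Y I \<otimes>\<^sub>m ident M I)"
    by (simp add: even_tens_comp)
  also have "\<dots> = (assoc M X Y I \<cdot> ((ident M X \<otimes>\<^sub>m runit M Y) \<otimes>\<^sub>m ident M I)) \<cdot>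
      (assoc M X Y I \<otimes>\<^sub>m ident M I)"
    by (rule even_comp_assoc[symmetric]) auto
  also have "\<dots> = (ident M X \<otimes>\<^sub>m runit M Y \<otimes>\<^sub>m ident M I) \<cdot> assoc M X (Y \<otimes>\<^sub>o I) I \<cdot>
      (assoc M X Y I \<otimes>\<^sub>m ident M I)"
    using even_assoc_natural[of "ident M X" "runit M Y" "ident M I"] by simp
  also have "\<dots> = ?l \<cdot> (ident M X \<otimes>\<^sub>m assoc M Y I I) \<cdot> assoc M X (Y \<otimes>\<^sub>o I) I \<cdot>
      (assoc M X Y I \<otimes>\<^sub>m ident M I)"
    by (simp add: even_tens_comp' triangle)
  also have "\<dots> = ?l \<cdot> assoc M X Y (I \<otimes>\<^sub>o I) \<cdot> assoc M (X \<otimes>\<^sub>o Y) I I"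
    by (simp add: pentagon)
  also have "\<dots> = (?l \<cdot> assoc M X Y (I \<otimes>\<^sub>o I)) \<cdot> assoc M (X \<otimes>\<^sub>o Y) I I"
    by (rule even_comp_assoc[symmetric]) auto
  also have "\<dots> = assoc M X Y I \<cdot> (ident M (X \<otimes>\<^sub>o Y) \<otimes>\<^sub>m lunit M I) \<cdot> assoc M (X \<otimes>\<^sub>o Y) I I"
    using even_assoc_natural[of "ident M X" "ident M Y" "lunit M I", symmetric] by simp
  also have "\<dots> = assoc M X Y I \<cdot> (runit M (X \<otimes>\<^sub>o Y) \<otimes>\<^sub>m ident M I)"
    by (simp add: triangle)
  finally show "((ident M X \<otimes>\<^sub>m runit M Y) \<cdot> assoc M X Y I) \<otimes>\<^sub>m ident M I =
      runit M (X \<otimes>\<^sub>o Y) \<otimes>\<^sub>m ident M I"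
    by (rule iso_mono[rotated 6]) (auto intro: assoc_iso)
qed auto

section \<open>The middle-four exchange\<close>

definition exchange_tail :: "'o \<Rightarrow> 'o \<Rightarrow> 'o \<Rightarrow> 'm" where
  "exchange_tail B C D =
     assoc M C B D \<cdot> (symm M B C \<otimes>\<^sub>m ident M D) \<cdot> inv_arr M (assoc M B C D)"

text \<open>\<open>mid_swap\<close> has only two object parameters. Four independent ones are
  required to state naturality, since discarding some factors of X, X, Y, Y turns them into
  units.\<close>

definition exchange :: "'o \<Rightarrow> 'o \<Rightarrow> 'o \<Rightarrow> 'o \<Rightarrow> 'm" where
  "exchange A B C D =
     inv_arr M (assoc M A C (B \<otimes>\<^sub>o D)) \<cdot> (ident M A \<otimes>\<^sub>m exchange_tail B C D) \<cdot>
       assoc M A B (C \<otimes>\<^sub>o D)"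

lemma mid_swap_eq_exchange: "mid_swap M X Y = exchange X X Y Y"
  by (simp add: mid_swap_def exchange_def exchange_tail_def)

lemma even_exchange_tail [simp]:
  assumes "B \<in> Obj M" "C \<in> Obj M" "D \<in> Obj M"
  shows "even_arr M (exchange_tail B C D)" "src M (exchange_tail B C D) = B \<otimes>\<^sub>o C \<otimes>\<^sub>o D"
    "trg M (exchange_tail B C D) = C \<otimes>\<^sub>o B \<otimes>\<^sub>o D"
  using assms by (auto simp: exchange_tail_def)

lemma even_exchange [simp]:
  assumes "A \<in> Obj M" "B \<in> Obj M" "C \<in> Obj M" "D \<in> Obj M"
  shows "even_arr M (exchange A B C D)"
    "src M (exchange A B C D) = (A \<otimes>\<^sub>o B) \<otimes>\<^sub>o C \<otimes>\<^sub>o D"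
    "trg M (exchange A B C D) = (A \<otimes>\<^sub>o C) \<otimes>\<^sub>o B \<otimes>\<^sub>o D"
  using assms by (auto simp: exchange_def)

lemma exchange_tail_natural:
  assumes [simp]: "even_arr M g" "even_arr M h" "even_arr M k"
  shows "exchange_tail (trg M g) (trg M h) (trg M k) \<cdot> (g \<otimes>\<^sub>m h \<otimes>\<^sub>m k) =
    (h \<otimes>\<^sub>m g \<otimes>\<^sub>m k) \<cdot> exchange_tail (src M g) (src M h) (src M k)"
proof -
  let ?a = "assoc M (trg M h) (trg M g) (trg M k)"
  let ?s = "symm M (trg M g) (trg M h) \<otimes>\<^sub>m ident M (trg M k)"
  let ?s' = "symm M (src M g) (src M h) \<otimes>\<^sub>m ident M (src M k)"
  let ?b = "inv_arr M (assoc M (src M g) (src M h) (src M k))"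
  have "exchange_tail (trg M g) (trg M h) (trg M k) \<cdot> (g \<otimes>\<^sub>m h \<otimes>\<^sub>m k) =
      ?a \<cdot> ?s \<cdot> ((g \<otimes>\<^sub>m h) \<otimes>\<^sub>m k) \<cdot> ?b"
    by (simp add: exchange_tail_def assoc_inv_natural)
  also have "\<dots> = ?a \<cdot> ((h \<otimes>\<^sub>m g) \<otimes>\<^sub>m k) \<cdot> ?s' \<cdot> ?b"
    by (simp add: even_tens_comp' even_symm_natural)
  also have "\<dots> = (?a \<cdot> ((h \<otimes>\<^sub>m g) \<otimes>\<^sub>m k)) \<cdot> ?s' \<cdot> ?b"
    by (rule even_comp_assoc[symmetric]) auto
  also have "\<dots> = (h \<otimes>\<^sub>m g \<otimes>\<^sub>m k) \<cdot> exchange_tail (src M g) (src M h) (src M k)"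
    by (simp add: exchange_tail_def even_assoc_natural)
  finally show ?thesis .
qed

lemma exchange_natural:
  assumes [simp]: "even_arr M f" "even_arr M g" "even_arr M h" "even_arr M k"
  shows "exchange (trg M f) (trg M g) (trg M h) (trg M k) \<cdot> ((f \<otimes>\<^sub>m g) \<otimes>\<^sub>m h \<otimes>\<^sub>m k) =
    ((f \<otimes>\<^sub>m h) \<otimes>\<^sub>m g \<otimes>\<^sub>m k) \<cdot> exchange (src M f) (src M g) (src M h) (src M k)"
proof -
  let ?b = "inv_arr M (assoc M (trg M f) (trg M h) (trg M g \<otimes>\<^sub>o trg M k))"
  let ?t = "ident M (trg M f) \<otimes>\<^sub>m exchange_tail (trg M g) (trg M h) (trg M k)"
  let ?t' = "ident M (src M f) \<otimes>\<^sub>m exchange_tail (src M g) (src M h) (src M k)"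
  let ?a = "assoc M (src M f) (src M g) (src M h \<otimes>\<^sub>o src M k)"
  have "exchange (trg M f) (trg M g) (trg M h) (trg M k) \<cdot> ((f \<otimes>\<^sub>m g) \<otimes>\<^sub>m h \<otimes>\<^sub>m k) =
      ?b \<cdot> ?t \<cdot> (f \<otimes>\<^sub>m g \<otimes>\<^sub>m h \<otimes>\<^sub>m k) \<cdot> ?a"
    using even_assoc_natural[of f g "h \<otimes>\<^sub>m k"] by (simp add: exchange_def)
  also have "\<dots> = ?b \<cdot> (f \<otimes>\<^sub>m h \<otimes>\<^sub>m g \<otimes>\<^sub>m k) \<cdot> ?t' \<cdot> ?a"
    by (simp add: even_tens_comp' exchange_tail_natural)
  also have "\<dots> = (?b \<cdot> (f \<otimes>\<^sub>m h \<otimes>\<^sub>m g \<otimes>\<^sub>m k)) \<cdot> ?t' \<cdot> ?a"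
    by (rule even_comp_assoc[symmetric]) auto
  also have "\<dots> = ((f \<otimes>\<^sub>m h) \<otimes>\<^sub>m g \<otimes>\<^sub>m k) \<cdot> exchange (src M f) (src M g) (src M h) (src M k)"
    using assoc_inv_natural[of f h "g \<otimes>\<^sub>m k"] by (simp add: exchange_def)
  finally show ?thesis .
qed

text \<open>The units at the two ends are absorbed one at a time, leaving the bare swap of the
  middle factors: the right one by \<open>runit_tens\<close> and naturality of \<open>runit\<close>,
  the left one by \<open>lunit_tens\<close> and naturality of \<open>lunit\<close>.\<close>

lemma exchange_outer_units:
  assumes [simp]: "X \<in> Obj M" "Y \<in> Obj M"
  shows "(lunit M Y \<otimes>\<^sub>m runit M X) \<cdot> exchange I X Y I =
    symm M X Y \<cdot> (lunit M X \<otimes>\<^sub>m runit M Y)"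
proof -
  let ?t = "exchange_tail X Y I"
  let ?a = "assoc M I X (Y \<otimes>\<^sub>o I)"
  have l: "(lunit M Y \<otimes>\<^sub>m ident M (X \<otimes>\<^sub>o I)) \<cdot> inv_arr M (assoc M I Y (X \<otimes>\<^sub>o I)) =
      lunit M (Y \<otimes>\<^sub>o X \<otimes>\<^sub>o I)"
    by (simp add: lunit_tens[symmetric])
  have r: "runit M (X \<otimes>\<^sub>o Y) \<cdot> inv_arr M (assoc M X Y I) = ident M X \<otimes>\<^sub>m runit M Y"
    by (simp add: runit_tens[symmetric])
  \<comment> \<open>With a unit in last place the tail of the exchange is the symmetry up to right
    unitors; this removes the right-hand unit.\<close>
  have t: "(ident M Y \<otimes>\<^sub>m runit M X) \<cdot> ?t = symm M X Y \<cdot> (ident M X \<otimes>\<^sub>m runit M Y)"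
  proof -
    have "(ident M Y \<otimes>\<^sub>m runit M X) \<cdot> ?t =
        ((ident M Y \<otimes>\<^sub>m runit M X) \<cdot> assoc M Y X I) \<cdot> (symm M X Y \<otimes>\<^sub>m ident M I) \<cdot>
          inv_arr M (assoc M X Y I)"
      unfolding exchange_tail_def by (rule even_comp_assoc[symmetric]) auto
    also have "\<dots> = (runit M (Y \<otimes>\<^sub>o X) \<cdot> (symm M X Y \<otimes>\<^sub>m ident M I)) \<cdot> inv_arr M (assoc M X Y I)"
      by (subst runit_tens) auto
    also have "\<dots> = symm M X Y \<cdot> runit M (X \<otimes>\<^sub>o Y) \<cdot> inv_arr M (assoc M X Y I)"
      using even_runit_natural[of "symm M X Y"] by simp
    finally show ?thesis by (simp add: r)
  qed
  \<comment> \<open>The unitors are separated so that the left one meets the inverse associator and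
    \<open>l\<close> applies; naturality then carries it past the tail.\<close>
  have "(lunit M Y \<otimes>\<^sub>m runit M X) \<cdot> exchange I X Y I =
      ((ident M Y \<otimes>\<^sub>m runit M X) \<cdot> (lunit M Y \<otimes>\<^sub>m ident M (X \<otimes>\<^sub>o I))) \<cdot> exchange I X Y I"
    by (subst even_tens_comp) auto
  also have "\<dots> = (ident M Y \<otimes>\<^sub>m runit M X) \<cdot>
      ((lunit M Y \<otimes>\<^sub>m ident M (X \<otimes>\<^sub>o I)) \<cdot> inv_arr M (assoc M I Y (X \<otimes>\<^sub>o I))) \<cdot>
      (ident M I \<otimes>\<^sub>m ?t) \<cdot> ?a"
    by (simp add: exchange_def del: tens_ident)
  also have "\<dots> = (ident M Y \<otimes>\<^sub>m runit M X) \<cdot> (lunit M (Y \<otimes>\<^sub>o X \<otimes>\<^sub>o I) \<cdot> (ident M I \<otimes>\<^sub>m ?t)) \<cdot> ?a"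
    by (subst l) auto
  also have "\<dots> = ((ident M Y \<otimes>\<^sub>m runit M X) \<cdot> ?t) \<cdot> lunit M (X \<otimes>\<^sub>o Y \<otimes>\<^sub>o I) \<cdot> ?a"
    using even_lunit_natural[of ?t] by simp
  also have "\<dots> = symm M X Y \<cdot> (ident M X \<otimes>\<^sub>m runit M Y) \<cdot> (lunit M X \<otimes>\<^sub>m ident M (Y \<otimes>\<^sub>o I))"
    unfolding t by (simp add: lunit_tens)
  also have "\<dots> = symm M X Y \<cdot> (lunit M X \<otimes>\<^sub>m runit M Y)"
    by (subst even_tens_comp) auto
  finally show ?thesis .
qed

end

section \<open>Marginals of copying\<close>

context quantum_cd_category
begin

lemma even_cd [simp]:
  assumes "X \<in> Obj M"
  shows "even_arr M (copy M X)" "src M (copy M X) = X" "trg M (copy M X) = X \<otimes>\<^sub>o X"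
    "even_arr M (discard M X)" "src M (discard M X) = X" "trg M (discard M X) = I"
  using copy_in_Hom[OF assms] discard_in_Hom[OF assms] by (auto simp: Hom_even_iff)

text \<open>
  The counit law at the unit object, where copying inverts the left unitor, makes the two
  unitors agree there.
\<close>

lemma symm_unit: "symm M I I = ident M (I \<otimes>\<^sub>o I)"
proof -
  note l = even_inv_arr[OF _ lunit_iso[of I]]
  have "runit M I \<cdot> inv_arr M (lunit M I) = ident M I"
    using copy_counit_right[of I] l by (simp add: discard_unit copy_unit)
  hence "(runit M I \<cdot> inv_arr M (lunit M I)) \<cdot> lunit M I = lunit M I" by simp
  hence "lunit M I \<cdot> symm M I I = lunit M I \<cdot> ident M (I \<otimes>\<^sub>o I)"
    using l by (simp add: runit_def)
  thus ?thesis
    by (rule iso_mono[rotated 6]) (auto intro: lunit_iso)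
qed

text \<open>The swap inside is that of the unit with itself, trivial by \<open>symm_unit\<close>;
  the remaining associators cancel against their inverses.\<close>

lemma exchange_inner_units:
  assumes [simp]: "X \<in> Obj M" "Y \<in> Obj M"
  shows "exchange X I I Y = ident M ((X \<otimes>\<^sub>o I) \<otimes>\<^sub>o I \<otimes>\<^sub>o Y)"
  by (simp add: exchange_def exchange_tail_def symm_unit)

text \<open>The unitor is bracketed with the tensor, as in the hypotheses of the theorem, so
  membership in \<open>CA\<close> follows by unfolding.\<close>

definition marg_left :: "'o \<Rightarrow> 'o \<Rightarrow> 'm" where
  "marg_left X Y = runit M X \<cdot> (ident M X \<otimes>\<^sub>m discard M Y)"

definition marg_right :: "'o \<Rightarrow> 'o \<Rightarrow> 'm" where
  "marg_right X Y = lunit M Y \<cdot> (discard M X \<otimes>\<^sub>m ident M Y)"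

lemma even_marg [simp]:
  assumes "X \<in> Obj M" "Y \<in> Obj M"
  shows "even_arr M (marg_left X Y)" "src M (marg_left X Y) = X \<otimes>\<^sub>o Y"
    "trg M (marg_left X Y) = X"
    "even_arr M (marg_right X Y)" "src M (marg_right X Y) = X \<otimes>\<^sub>o Y"
    "trg M (marg_right X Y) = Y"
  using assms by (auto simp: marg_left_def marg_right_def)

lemma marg_copy:
  assumes [simp]: "X \<in> Obj M"
  shows "marg_left X X \<cdot> copy M X = ident M X" "marg_right X X \<cdot> copy M X = ident M X"
  using copy_counit_left[of X] copy_counit_right[of X]
  by (auto simp: marg_left_def marg_right_def)

text \<open>The discards pass through the exchange onto the inner copies. There the exchange becomes
  trivial and the counit laws for X and Y remain.\<close>

lemma marg_left_right_copy:
  assumes [simp]: "X \<in> Obj M" "Y \<in> Obj M"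
  shows "(marg_left X Y \<otimes>\<^sub>m marg_right X Y) \<cdot> copy M (X \<otimes>\<^sub>o Y) = ident M (X \<otimes>\<^sub>o Y)"
proof -
  let ?u = "runit M X \<otimes>\<^sub>m lunit M Y"
  let ?d = "(ident M X \<otimes>\<^sub>m discard M X) \<otimes>\<^sub>m discard M Y \<otimes>\<^sub>m ident M Y"
  let ?d' = "(ident M X \<otimes>\<^sub>m discard M Y) \<otimes>\<^sub>m discard M X \<otimes>\<^sub>m ident M Y"
  have "(marg_left X Y \<otimes>\<^sub>m marg_right X Y) \<cdot> copy M (X \<otimes>\<^sub>o Y) =
      (?u \<cdot> ?d') \<cdot> exchange X X Y Y \<cdot> (copy M X \<otimes>\<^sub>m copy M Y)"
    by (simp add: marg_left_def marg_right_def even_tens_comp copy_tens mid_swap_eq_exchange)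
  also have "\<dots> = ?u \<cdot> (?d' \<cdot> exchange X X Y Y) \<cdot> (copy M X \<otimes>\<^sub>m copy M Y)"
    by simp
  \<comment> \<open>Naturality yields \<open>exchange X I I Y\<close> after \<open>?d\<close>, and
    that exchange is an identity.\<close>
  also have "?d' \<cdot> exchange X X Y Y = ?d"
    using exchange_natural[of "ident M X" "discard M X" "discard M Y" "ident M Y"]
    by (simp add: exchange_inner_units)
  also have "?u \<cdot> ?d \<cdot> (copy M X \<otimes>\<^sub>m copy M Y) =
      (marg_left X X \<cdot> copy M X) \<otimes>\<^sub>m (marg_right Y Y \<cdot> copy M Y)"
    by (simp add: marg_left_def marg_right_def even_tens_comp)
  finally show ?thesis by (simp add: marg_copy)
qed

text \<open>Here the discards fall on the outer copies, so the exchange survives as the symmetry by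
  \<open>exchange_outer_units\<close>; the counit laws remove the rest.\<close>

lemma marg_right_left_copy:
  assumes [simp]: "X \<in> Obj M" "Y \<in> Obj M"
  shows "(marg_right X Y \<otimes>\<^sub>m marg_left X Y) \<cdot> copy M (X \<otimes>\<^sub>o Y) = symm M X Y"
proof -
  let ?u = "lunit M Y \<otimes>\<^sub>m runit M X"
  let ?d = "(discard M X \<otimes>\<^sub>m ident M X) \<otimes>\<^sub>m ident M Y \<otimes>\<^sub>m discard M Y"
  let ?d' = "(discard M X \<otimes>\<^sub>m ident M Y) \<otimes>\<^sub>m ident M X \<otimes>\<^sub>m discard M Y"
  have "(marg_right X Y \<otimes>\<^sub>m marg_left X Y) \<cdot> copy M (X \<otimes>\<^sub>o Y) =
      (?u \<cdot> ?d') \<cdot> exchange X X Y Y \<cdot> (copy M X \<otimes>\<^sub>m copy M Y)"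
    by (simp add: marg_left_def marg_right_def even_tens_comp copy_tens mid_swap_eq_exchange)
  also have "\<dots> = ?u \<cdot> (?d' \<cdot> exchange X X Y Y) \<cdot> (copy M X \<otimes>\<^sub>m copy M Y)"
    by simp
  also have "?d' \<cdot> exchange X X Y Y = exchange I X Y I \<cdot> ?d"
    using exchange_natural[of "discard M X" "ident M X" "ident M Y" "discard M Y"] by simp
  also have "?u \<cdot> (exchange I X Y I \<cdot> ?d) \<cdot> (copy M X \<otimes>\<^sub>m copy M Y) =
      (?u \<cdot> exchange I X Y I) \<cdot> ?d \<cdot> (copy M X \<otimes>\<^sub>m copy M Y)"
    by simp
  also have "\<dots> = symm M X Y \<cdot> ((marg_right X X \<cdot> copy M X) \<otimes>\<^sub>m (marg_left Y Y \<cdot> copy M Y))"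
    unfolding exchange_outer_units[OF assms]
    by (simp add: marg_left_def marg_right_def even_tens_comp)
  finally show ?thesis by (simp add: marg_copy)
qed

text \<open>Supplies the determinism premise of \<open>S_positive\<close>, where the composite of
  \<open>nabla X\<close> with a marginal is an identity.\<close>

lemma deterministic_ident:
  assumes [simp]: "X \<in> Obj M"
  shows "deterministic M (ident M X)"
proof -
  have "star M X \<in> Arr M" "src M (star M X) = X" "trg M (star M X) = X"
    using star_in_Hom[of X] by (auto simp: Hom_def)
  moreover have "ident M X \<in> Arr M" "grade M (ident M X) = 0"
    using even_ident(1)[of X] by (auto simp: even_arr_def)
  ultimately show ?thesis
    using comp_ident[of "star M X"] ident_comp[of "star M X"]
    by (simp add: deterministic_def star_preserving_def)
qed

end

section \<open>Comparison of \<open>nabla\<close> with copying\<close>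

theorem theorem4p17:
  fixes M :: "('o, 'm, 'b) quantum_cd_category_scheme" (structure)
    and CO :: "'o set" and CA :: "'m set"
    and nabla :: "'o \<Rightarrow> 'm"
  assumes "quantum_markov_category M"
    and "S_positive_subcategory M CO CA"
    and "\<And>X. X \<in> CO \<Longrightarrow> discard M X \<in> CA"
    and "\<And>X. X \<in> CO \<Longrightarrow> lunit M X \<cdot> (discard M X \<otimes>\<^sub>m ident M X) \<in> CA"
    and "\<And>X. X \<in> CO \<Longrightarrow> runit M X \<cdot> (ident M X \<otimes>\<^sub>m discard M X) \<in> CA"
    and "\<And>X. X \<in> CO \<Longrightarrow> nabla X \<in> CA"
    and "\<And>X. X \<in> CO \<Longrightarrow> src M (nabla X) = X \<and> trg M (nabla X) = X \<otimes>\<^sub>o X"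
    and "\<And>X. X \<in> CO \<Longrightarrow> (lunit M X \<cdot> (discard M X \<otimes>\<^sub>m ident M X)) \<cdot> nabla X = ident M X"
    and "\<And>X. X \<in> CO \<Longrightarrow> (runit M X \<cdot> (ident M X \<otimes>\<^sub>m discard M X)) \<cdot> nabla X = ident M X"
  shows "\<forall>X\<in>CO. symm M X X \<cdot> nabla X = nabla X \<and> nabla X = copy M X"
proof
  fix X
  assume X: "X \<in> CO"
  interpret quantum_markov_category M by fact
  interpret S_positive_subcategory M CO CA by fact
  have [simp]: "X \<in> Obj M" using X sub_Obj by blast
  have n [simp]: "even_arr M (nabla X)" "src M (nabla X) = X" "trg M (nabla X) = X \<otimes>\<^sub>o X"
    using assms(6,7)[OF X] sub_Arr sub_even by (auto simp: even_arr_def)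
  have p: "marg_left X X \<in> CA" "marg_left X X \<cdot> nabla X = ident M X"
    and q: "marg_right X X \<in> CA" "marg_right X X \<cdot> nabla X = ident M X"
    using assms(4,5,8,9)[OF X] by (auto simp: marg_left_def marg_right_def)
  \<comment> \<open>Stated for an arbitrary pair of left inverses of \<open>nabla X\<close>, so that
    it serves for both orders of the marginals. Membership in \<open>CA\<close> is asked of
    \<open>f\<close> because S-positivity is applied to \<open>f\<close>.\<close>
  have split: "(f \<otimes>\<^sub>m g) \<cdot> copy M (X \<otimes>\<^sub>o X) \<cdot> nabla X = copy M X"
    if f: "f \<in> CA" "f \<cdot> nabla X = ident M X" "even_arr M f" "src M f = X \<otimes>\<^sub>o X" "trg M f = X"
      and g: "g \<cdot> nabla X = ident M X" "even_arr M g" "src M g = X \<otimes>\<^sub>o X" "trg M g = X" for f g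
  proof -
    have "(f \<otimes>\<^sub>m g) \<cdot> copy M (X \<otimes>\<^sub>o X) \<cdot> nabla X =
        (ident M X \<otimes>\<^sub>m g) \<cdot> (f \<otimes>\<^sub>m ident M (X \<otimes>\<^sub>o X)) \<cdot> copy M (X \<otimes>\<^sub>o X) \<cdot> nabla X"
      using f g by (simp add: even_tens_comp')
    \<comment> \<open>S-positivity for \<open>nabla X\<close> followed by \<open>f\<close> turns the
      copy of the joint output into a copy of the input, with \<open>nabla X\<close> left in the
      second factor for \<open>g\<close> to undo.\<close>
    also have "\<dots> = (ident M X \<otimes>\<^sub>m g) \<cdot> (ident M X \<otimes>\<^sub>m nabla X) \<cdot> copy M X"
      using S_positive[OF assms(6)[OF X] f(1)] f deterministic_ident[of X] by simp
    also have "\<dots> = copy M X"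
      using g by (simp add: even_tens_comp')
    finally show ?thesis .
  qed
  have "nabla X = ((marg_left X X \<otimes>\<^sub>m marg_right X X) \<cdot> copy M (X \<otimes>\<^sub>o X)) \<cdot> nabla X"
    by (subst marg_left_right_copy) auto
  also have "\<dots> = copy M X"
    using split[of "marg_left X X" "marg_right X X"] p q by simp
  finally have nabla: "nabla X = copy M X" .
  \<comment> \<open>The same computation with the marginals interchanged: their pairing is now the
    symmetry, while \<open>split\<close> still returns \<open>copy M X\<close>.\<close>
  have "symm M X X \<cdot> nabla X =
      ((marg_right X X \<otimes>\<^sub>m marg_left X X) \<cdot> copy M (X \<otimes>\<^sub>o X)) \<cdot> nabla X"
    by (subst marg_right_left_copy) auto
  also have "\<dots> = copy M X"
    using split[of "marg_right X X" "marg_left X X"] p q by simp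
  finally show "symm M X X \<cdot> nabla X = nabla X \<and> nabla X = copy M X"
    using nabla by simp
qed

end
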